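(* Let $G$ be a compact group. Then the following are equivalent: (a) $G$ is an FC-group; (b) the center $Z(G)$ of $G$ is open in $G$ (that is, $G/Z(G)$ is finite); (c) the commutator subgroup $G'$ of $G$ is finite.
   Context: Compact groups are Hausdorff topological groups. An FC-group is a group in which the conjugacy class of every element is finite. $G'$ denotes the (algebraic) commutator subgroup, generated by all commutators $[x,y]$ with $x,y\in G$. *)

theory Defs
  imports "HOL-Analysis.Analysis" "HOL-Algebra.Algebra"
begin

locale topological_group = group G
  for G :: "('a, 'b) monoid_scheme" (structure) and T :: "'a topology" +
  assumes topspace_eq: "topspace T = carrier G"
    and continuous_mult: "continuous_map (prod_topology T T) T (\<lambda>(x, y). x \<otimes> y)"
    and continuous_inv: "continuous_map T T (\<lambda>x. inv x)"

text \<open>Compactness does not include the Hausdorff axiom in the library's \<^const>\<open>compact_space\<close>.\<close>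

locale compact_group = topological_group +
  assumes compact: "compact_space T"
    and Hausdorff: "Hausdorff_space T"

definition conjugacy_class :: "('a, 'b) monoid_scheme \<Rightarrow> 'a \<Rightarrow> 'a set"
  where "conjugacy_class G x = {g \<otimes>\<^bsub>G\<^esub> x \<otimes>\<^bsub>G\<^esub> inv\<^bsub>G\<^esub> g | g. g \<in> carrier G}"

locale FC_group = group +
  assumes finite_conjugacy_class: "x \<in> carrier G \<Longrightarrow> finite (conjugacy_class G x)"

definition group_center :: "('a, 'b) monoid_scheme \<Rightarrow> 'a set"
  where "group_center G = {z \<in> carrier G. \<forall>g \<in> carrier G. z \<otimes>\<^bsub>G\<^esub> g = g \<otimes>\<^bsub>G\<^esub> z}"

text \<open>The algebraic commutator subgroup is the library's \<^term>\<open>derived G (carrier G)\<close>: the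
  subgroup generated by all commutators, without topological closure.\<close>

end

(* Schur's theorem: if Z(G) has index n, there are finitely many commutators, and the (n+1)-st power
   of a commutator is a product of n commutators, so every element of G' is a product of boundedly
   many commutators.  If G' is finite, then so is each conjugacy class, which lies in G'x.

   If G is an FC-group, Baire's theorem gives a nonempty open set on which class sizes are bounded;
   let the class of x be of maximal size there, with conjugating elements E.  For v near 1, the
   elements of E also yield the whole class of xv, so the commutators of v with E and with the
   centralizer of x range over a finite set independent of v.  As [g,v] tends to 1 with v, uniformly
   in g by compactness, these commutators are trivial for v near 1.  Since G is generated by E and the
   centralizer of x, the center is a neighborhood of 1. *)

theory Submission
  imports Defs
begin

section \<open>Words over a conjugation-invariant set\<close>

context group
begin

lemma conj_eq_commutator_mult:
  assumes "x \<in> carrier G" "y \<in> carrier G"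
  shows "x \<otimes> y \<otimes> inv x = (x \<otimes> y \<otimes> inv x \<otimes> inv y) \<otimes> y"
  using assms by (simp add: m_assoc)

lemma inv_mult_cancel_left [simp]:
  assumes "x \<in> carrier G" "y \<in> carrier G"
  shows "inv x \<otimes> (x \<otimes> y) = y" "x \<otimes> (inv x \<otimes> y) = y"
  using assms by (simp_all flip: m_assoc)

lemma nat_pow_conj:
  assumes "g \<in> carrier G" "c \<in> carrier G"
  shows "(g \<otimes> c \<otimes> inv g) [^] (n::nat) = g \<otimes> c [^] n \<otimes> inv g"
  using assms by (induction n) (simp_all add: m_assoc)

abbreviation list_prod :: "'a list \<Rightarrow> 'a"
  where "list_prod xs \<equiv> foldr (\<otimes>) xs \<one>"

lemma list_prod_append:
  assumes "set xs \<subseteq> carrier G" "set ys \<subseteq> carrier G"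
  shows "list_prod (xs @ ys) = list_prod xs \<otimes> list_prod ys"
  using assms by (induction xs) (simp_all add: m_assoc)

lemma list_prod_replicate:
  assumes "x \<in> carrier G"
  shows "list_prod (replicate n x) = x [^] n"
  using assms nat_pow_Suc2[symmetric] by (induction n) simp_all

text \<open>Copies of \<open>c\<close> are collected from left to right. A factor \<open>x\<close>
  that is not collected is moved past the collected power by the identity x c^k = c^k (c^(-k) x
  c^k). The conjugate lies in \<open>C\<close> again, so the number of remaining factors is exactly
  the old length minus \<open>k\<close>.\<close>

lemma list_prod_extract_power:
  assumes C: "C \<subseteq> carrier G"
    and conj: "\<And>g x. g \<in> carrier G \<Longrightarrow> x \<in> C \<Longrightarrow> g \<otimes> x \<otimes> inv g \<in> C"
    and "c \<in> carrier G" "set xs \<subseteq> C" "k \<le> count_list xs c"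
  obtains ys where "set ys \<subseteq> C" "length ys = length xs - k"
    "list_prod xs = c [^] k \<otimes> list_prod ys"
proof -
  have "\<exists>ys. set ys \<subseteq> C \<and> length ys = length xs - k \<and> list_prod xs = c [^] k \<otimes> list_prod ys"
    using assms(4,5)
  proof (induction xs arbitrary: k)
    case Nil
    then show ?case by simp
  next
    case (Cons x xs)
    have xC: "x \<in> C" "x \<in> carrier G" and xs: "set xs \<subseteq> C" "set xs \<subseteq> carrier G"
      using Cons.prems(1) C by auto
    show ?case
    proof (cases "x = c \<and> k > 0")
      case True
      then obtain j where j: "k = Suc j" using gr0_implies_Suc by blast
      with Cons.prems True have "j \<le> count_list xs c" by simp
      then obtain ys where ys: "set ys \<subseteq> C" "length ys = length xs - j"
        "list_prod xs = c [^] j \<otimes> list_prod ys"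
        using Cons.IH xs by blast
      then have "set ys \<subseteq> carrier G" using C by blast
      then have "list_prod (x # xs) = c [^] k \<otimes> list_prod ys"
        using ys True j \<open>c \<in> carrier G\<close> nat_pow_Suc2[of c j] by (simp flip: m_assoc)
      with ys j show ?thesis by auto
    next
      case False
      then have k: "k \<le> count_list xs c" using Cons.prems by (auto split: if_splits)
      then obtain ys where ys: "set ys \<subseteq> C" "length ys = length xs - k"
        "list_prod xs = c [^] k \<otimes> list_prod ys"
        using Cons.IH xs by blast
      define x' where "x' = inv (c [^] k) \<otimes> x \<otimes> inv (inv (c [^] k))"
      have x': "x' \<in> C" unfolding x'_def using xC \<open>c \<in> carrier G\<close> by (intro conj) simp_all
      have "set ys \<subseteq> carrier G" using C ys by blast
      then have "list_prod (x # xs) = c [^] k \<otimes> list_prod (x' # ys)"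
        using ys xC \<open>c \<in> carrier G\<close> by (simp add: x'_def m_assoc)
      moreover have "length (x' # ys) = length (x # xs) - k"
        using ys k count_le_length[of xs c] by simp
      ultimately show ?thesis using x' ys by (intro exI[of _ "x' # ys"]) simp
    qed
  qed
  then show ?thesis using that by blast
qed

text \<open>A long product contains some \<open>c \<in> C\<close> more than \<open>n\<close> times; gathering \<open>n + 1\<close> copies of \<open>c\<close>
  in front by conjugation and rewriting \<open>c\<^sup>n\<^sup>+\<^sup>1\<close> as \<open>n\<close> factors shortens it.\<close>

lemma list_prod_shorten:
  assumes C: "C \<subseteq> carrier G" "finite C"
    and conj: "\<And>g x. g \<in> carrier G \<Longrightarrow> x \<in> C \<Longrightarrow> g \<otimes> x \<otimes> inv g \<in> C"
    and pow: "\<And>c. c \<in> C \<Longrightarrow> \<exists>zs. set zs \<subseteq> C \<and> length zs = n \<and> c [^] Suc n = list_prod zs"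
    and "set xs \<subseteq> C"
  shows "\<exists>ys. set ys \<subseteq> C \<and> length ys \<le> n * card C \<and> list_prod xs = list_prod ys"
  using \<open>set xs \<subseteq> C\<close>
proof (induction xs rule: length_induct)
  case (1 xs)
  show ?case
  proof (cases "length xs \<le> n * card C")
    case True
    then show ?thesis using 1 by blast
  next
    case False
    have "\<exists>c\<in>C. Suc n \<le> count_list xs c"
    proof (rule ccontr)
      assume "\<not> ?thesis"
      then have "sum (count_list xs) C \<le> of_nat (card C) * n"
        by (intro sum_bounded_above) (simp add: not_less_eq_eq)
      with False 1 C show False by (simp add: sum_count_set mult.commute)
    qed
    then obtain c where c: "c \<in> C" "Suc n \<le> count_list xs c" by blast
    then obtain ys where ys: "set ys \<subseteq> C" "length ys = length xs - Suc n"
      "list_prod xs = c [^] Suc n \<otimes> list_prod ys"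
      using list_prod_extract_power[OF C(1) conj, of c xs "Suc n"] C 1 by blast
    obtain zs where zs: "set zs \<subseteq> C" "length zs = n" "c [^] Suc n = list_prod zs"
      using pow c by blast
    have "list_prod xs = list_prod (zs @ ys)"
      using ys zs C list_prod_append[of zs ys] by auto
    moreover have "length (zs @ ys) < length xs"
      using ys zs c count_le_length[of xs c] by simp
    moreover have "set (zs @ ys) \<subseteq> C" using ys zs by simp
    ultimately show ?thesis using 1 by metis
  qed
qed

text \<open>Since \<open>C\<close> is closed under inverses, words in the elements of
  \<open>C\<close> alone already form a subgroup; the empty word gives the identity.\<close>

lemma generate_subset_list_prod:
  assumes C: "C \<subseteq> carrier G" and inv: "\<And>x. x \<in> C \<Longrightarrow> inv x \<in> C"
  shows "generate G C \<subseteq> list_prod ` {xs. set xs \<subseteq> C}"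
proof
  fix x assume "x \<in> generate G C"
  then show "x \<in> list_prod ` {xs. set xs \<subseteq> C}"
  proof induction
    case one
    show ?case by (rule image_eqI[of _ _ "[]"]) simp_all
  next
    case (incl h)
    then show ?case using C by (intro image_eqI[of _ _ "[h]"]) auto
  next
    case (inv h)
    then show ?case using C assms(2) by (intro image_eqI[of _ _ "[inv h]"]) auto
  next
    case (eng h1 h2)
    then obtain xs ys where "set xs \<subseteq> C" "h1 = list_prod xs" "set ys \<subseteq> C" "h2 = list_prod ys"
      by auto
    then show ?case using C list_prod_append[of xs ys] by (intro image_eqI[of _ _ "xs @ ys"]) auto
  qed
qed

text \<open>Every element of the generated subgroup is a word over \<open>C\<close>, and shortening
  brings its length down to at most \<open>n * card C\<close>. Over a finite alphabet there are only
  finitely many such words. For Schur's theorem, \<open>C\<close> will be the set of commutators and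
  \<open>n\<close> the index of the center.\<close>

lemma finite_generate:
  assumes C: "C \<subseteq> carrier G" "finite C"
    and inv: "\<And>x. x \<in> C \<Longrightarrow> inv x \<in> C"
    and conj: "\<And>g x. g \<in> carrier G \<Longrightarrow> x \<in> C \<Longrightarrow> g \<otimes> x \<otimes> inv g \<in> C"
    and pow: "\<And>c. c \<in> C \<Longrightarrow> \<exists>zs. set zs \<subseteq> C \<and> length zs = n \<and> c [^] Suc n = list_prod zs"
  shows "finite (generate G C)"
proof (rule finite_subset)
  show "generate G C \<subseteq> list_prod ` {ys. set ys \<subseteq> C \<and> length ys \<le> n * card C}"
    using generate_subset_list_prod[OF C(1) inv] list_prod_shorten[OF C conj pow]
    by (fastforce simp: image_iff)
  show "finite (list_prod ` {ys. set ys \<subseteq> C \<and> length ys \<le> n * card C})"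
    using C by (intro finite_imageI finite_lists_length_le)
qed

section \<open>Closure properties of the set of commutators\<close>

lemma conj_mem_derived_set:
  assumes "g \<in> carrier G" "c \<in> derived_set G (carrier G)"
  shows "g \<otimes> c \<otimes> inv g \<in> derived_set G (carrier G)"
proof -
  obtain x y where xy: "x \<in> carrier G" "y \<in> carrier G" and c: "c = x \<otimes> y \<otimes> inv x \<otimes> inv y"
    using assms by blast
  have "g \<otimes> c \<otimes> inv g = (g \<otimes> x \<otimes> inv g) \<otimes> (g \<otimes> y \<otimes> inv g)
      \<otimes> inv (g \<otimes> x \<otimes> inv g) \<otimes> inv (g \<otimes> y \<otimes> inv g)"
    using assms(1) xy unfolding c by (simp add: m_assoc inv_mult_group)
  then show ?thesis using assms(1) xy by auto
qed

lemma inv_mem_derived_set: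
  assumes "c \<in> derived_set G (carrier G)"
  shows "inv c \<in> derived_set G (carrier G)"
proof -
  obtain x y where xy: "x \<in> carrier G" "y \<in> carrier G" and c: "c = x \<otimes> y \<otimes> inv x \<otimes> inv y"
    using assms by blast
  have "inv c = y \<otimes> x \<otimes> inv y \<otimes> inv x"
    using xy unfolding c by (simp add: m_assoc inv_mult_group)
  then show ?thesis using xy by auto
qed

section \<open>The center and Schur's theorem\<close>

lemma group_centerD:
  assumes "z \<in> group_center G" "g \<in> carrier G"
  shows "z \<otimes> g = g \<otimes> z"
  using assms by (simp add: group_center_def)

lemma normal_group_center: "group_center G \<lhd> G"
proof (rule normal_invI)
  show "subgroup (group_center G) G"
  proof (rule subgroupI)
    show "inv z \<in> group_center G" if "z \<in> group_center G" for z
      using that by (auto simp: group_center_def) (metis inv_closed inv_inv inv_mult_group)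
    show "z \<otimes> w \<in> group_center G"
      if z: "z \<in> group_center G" and w: "w \<in> group_center G" for z w
    proof -
      have zw: "z \<in> carrier G" "w \<in> carrier G"
        using z w by (auto simp: group_center_def)
      have "z \<otimes> w \<otimes> g = g \<otimes> (z \<otimes> w)" if g: "g \<in> carrier G" for g
      proof -
        have "z \<otimes> (w \<otimes> g) = z \<otimes> g \<otimes> w"
          using zw g group_centerD[OF w g] by (simp add: m_assoc)
        then show ?thesis
          using zw g group_centerD[OF z g] by (simp add: m_assoc)
      qed
      with zw show ?thesis unfolding group_center_def by blast
    qed
  qed (auto simp: group_center_def)
  show "x \<otimes> h \<otimes> inv x \<in> group_center G" if "x \<in> carrier G" "h \<in> group_center G" for x h
  proof -
    have hG: "h \<in> carrier G" using that by (simp add: group_center_def)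
    have "x \<otimes> h \<otimes> inv x = h"
      using hG that(1) group_centerD[OF that(2,1), symmetric] by (simp add: m_assoc)
    then show ?thesis using that by simp
  qed
qed

text \<open>Split off one factor c = x y x^(-1) y^(-1) and move its last letter y^(-1) to the right
  of the central power c^(m+1). Expanding one more \<open>c\<close> of that power makes x y x^(-1)
  meet itself, giving x y^2 x^(-1) y^(-1) c^m y^(-1) = [x, y^2] (y c y^(-1))^m. The power c^(m+2)
  thus becomes a product of only m+1 commutators, the saving that drives the shortening of
  words.\<close>

lemma commutator_power:
  assumes xy: "x \<in> carrier G" "y \<in> carrier G" and c: "c = x \<otimes> y \<otimes> inv x \<otimes> inv y"
    and central: "c [^] Suc m \<in> group_center G"
  shows "c [^] Suc (Suc m)
    = (x \<otimes> (y \<otimes> y) \<otimes> inv x \<otimes> inv (y \<otimes> y)) \<otimes> (y \<otimes> c \<otimes> inv y) [^] m"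
proof -
  have cG: "c \<in> carrier G" using xy c by simp
  have pow: "c [^] Suc m = c \<otimes> c [^] m" using cG nat_pow_Suc2 by blast
  have "c [^] Suc (Suc m) = c \<otimes> c [^] Suc m" using cG nat_pow_Suc2 by blast
  also have "\<dots> = x \<otimes> y \<otimes> inv x \<otimes> (inv y \<otimes> c [^] Suc m)"
    using xy cG by (subst (1) c) (simp add: m_assoc del: nat_pow_Suc)
  also have "inv y \<otimes> c [^] Suc m = c [^] Suc m \<otimes> inv y"
    using central xy by (simp add: group_center_def del: nat_pow_Suc)
  also have "c [^] Suc m \<otimes> inv y = x \<otimes> y \<otimes> inv x \<otimes> inv y \<otimes> c [^] m \<otimes> inv y"
    unfolding pow by (subst (1) c) simp
  finally show ?thesis
    unfolding nat_pow_conj[OF xy(2) cG] using xy cG by (simp add: m_assoc inv_mult_group del: nat_pow_Suc)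
qed

text \<open>Lagrange's theorem in the quotient: the coset of \<open>x\<close>, raised to the order
  of the quotient, is trivial.\<close>

lemma pow_index_mem:
  assumes "N \<lhd> G" "finite (carrier (G Mod N))" "x \<in> carrier G"
  shows "x [^] card (carrier (G Mod N)) \<in> N"
proof -
  interpret N: normal N G by fact
  interpret Q: group "G Mod N" by (rule N.factorgroup_is_group)
  have "N #> x \<in> carrier (G Mod N)" using assms by (simp add: carrier_FactGroup)
  then have "(N #> x) [^]\<^bsub>G Mod N\<^esub> order (G Mod N) = N"
    using Q.pow_order_eq_1 by simp
  then have "N #> x [^] order (G Mod N) = N"
    using assms by (simp add: N.FactGroup_pow)
  then show ?thesis
    using assms rcos_self[OF _ N.is_subgroup, of "x [^] order (G Mod N)"]
    by (simp add: order_def)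
qed

lemma finite_index_transversal:
  assumes "subgroup H G" "finite (carrier (G Mod H))"
  obtains R where "finite R" "R \<subseteq> carrier G"
    "\<And>x. x \<in> carrier G \<Longrightarrow> \<exists>h\<in>H. \<exists>r\<in>R. x = h \<otimes> r"
proof -
  obtain R where R: "R \<subseteq> carrier G" "finite R" "(\<lambda>x. H #> x) ` carrier G = (\<lambda>x. H #> x) ` R"
    using finite_subset_image[of "(\<lambda>x. H #> x) ` carrier G" "\<lambda>x. H #> x" "carrier G"] assms
    by (auto simp: carrier_FactGroup)
  have "\<exists>h\<in>H. \<exists>r\<in>R. x = h \<otimes> r" if x: "x \<in> carrier G" for x
  proof -
    obtain r where "r \<in> R" "H #> x = H #> r" using R x by (metis image_eqI imageE)
    then have "x \<in> H #> r" using rcos_self[OF x assms(1)] by simp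
    with \<open>r \<in> R\<close> show ?thesis by (auto simp: r_coset_def)
  qed
  with R that show ?thesis by blast
qed

text \<open>Central factors cancel against their inverses, so a commutator depends only on the
  cosets of its two entries modulo the center. Finite index of the center therefore leaves only
  finitely many commutators.\<close>

lemma commutator_center_mult:
  assumes z: "z \<in> group_center G" "w \<in> group_center G" and x: "x \<in> carrier G" "y \<in> carrier G"
  shows "(z \<otimes> x) \<otimes> (w \<otimes> y) \<otimes> inv (z \<otimes> x) \<otimes> inv (w \<otimes> y) = x \<otimes> y \<otimes> inv x \<otimes> inv y"
proof -
  have zw: "z \<in> carrier G" "w \<in> carrier G" using z by (auto simp: group_center_def)
  have "(z \<otimes> x) \<otimes> (w \<otimes> y) \<otimes> inv (z \<otimes> x) \<otimes> inv (w \<otimes> y)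
      = (z \<otimes> (x \<otimes> (w \<otimes> (y \<otimes> inv x)))) \<otimes> inv z \<otimes> inv y \<otimes> inv w"
    using zw x by (simp add: m_assoc inv_mult_group)
  also have "z \<otimes> (x \<otimes> (w \<otimes> (y \<otimes> inv x))) = (x \<otimes> (w \<otimes> (y \<otimes> inv x))) \<otimes> z"
    using zw x z by (intro group_centerD) auto
  also have "w \<otimes> (y \<otimes> inv x) = (y \<otimes> inv x) \<otimes> w"
    using zw x z by (intro group_centerD) auto
  finally have "(z \<otimes> x) \<otimes> (w \<otimes> y) \<otimes> inv (z \<otimes> x) \<otimes> inv (w \<otimes> y)
      = x \<otimes> y \<otimes> inv x \<otimes> (w \<otimes> inv y) \<otimes> inv w"
    using zw x by (simp add: m_assoc)
  also have "w \<otimes> inv y = inv y \<otimes> w"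
    using x z by (intro group_centerD) auto
  finally show ?thesis using zw x by (simp add: m_assoc)
qed

lemma Schur_finite_derived:
  assumes "finite (carrier (G Mod group_center G))"
  shows "finite (derived G (carrier G))"
proof -
  interpret Z: normal "group_center G" G by (rule normal_group_center)
  let ?C = "derived_set G (carrier G)"
  let ?n = "card (carrier (G Mod group_center G))"
  obtain R where R: "finite R" "R \<subseteq> carrier G"
    "\<And>x. x \<in> carrier G \<Longrightarrow> \<exists>h\<in>group_center G. \<exists>r\<in>R. x = h \<otimes> r"
    using finite_index_transversal[OF Z.is_subgroup assms] by metis
  have "?C \<subseteq> (\<lambda>(x, y). x \<otimes> y \<otimes> inv x \<otimes> inv y) ` (R \<times> R)"
  proof
    fix c assume "c \<in> ?C"
    then obtain x y where "x \<in> carrier G" "y \<in> carrier G" and c: "c = x \<otimes> y \<otimes> inv x \<otimes> inv y"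
      by blast
    then obtain z r w s where zr: "z \<in> group_center G" "r \<in> R" "x = z \<otimes> r"
      "w \<in> group_center G" "s \<in> R" "y = w \<otimes> s"
      using R(3) by meson
    then have "c = r \<otimes> s \<otimes> inv r \<otimes> inv s"
      using R(2) commutator_center_mult[of z w r s] c by blast
    with zr show "c \<in> (\<lambda>(x, y). x \<otimes> y \<otimes> inv x \<otimes> inv y) ` (R \<times> R)" by force
  qed
  then have fin: "finite ?C" using R(1) by (meson finite_SigmaI finite_imageI finite_subset)
  have sub: "?C \<subseteq> carrier G" by (rule derived_set_in_carrier) simp
  \<comment> \<open>The index is written as m+1 so that c^(m+1), which is central by Lagrange, has
    the exponent demanded by \<open>commutator_power\<close>.\<close>
  have "?n > 0" using assms one_closed by (auto simp: card_gt_0_iff carrier_FactGroup)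
  then obtain m where m: "?n = Suc m" using gr0_implies_Suc by blast
  have pow: "\<exists>zs. set zs \<subseteq> ?C \<and> length zs = ?n \<and> c [^] Suc ?n = list_prod zs" if cC: "c \<in> ?C" for c
  proof -
    obtain x y where xy: "x \<in> carrier G" "y \<in> carrier G" and c: "c = x \<otimes> y \<otimes> inv x \<otimes> inv y"
      using cC by blast
    let ?d = "x \<otimes> (y \<otimes> y) \<otimes> inv x \<otimes> inv (y \<otimes> y)" and ?e = "y \<otimes> c \<otimes> inv y"
    have d: "?d \<in> ?C" using xy m_closed by blast
    have eG: "?e \<in> carrier G" using xy c by simp
    have e: "?e \<in> ?C" by (rule conj_mem_derived_set[OF xy(2) cC])
    have "c [^] Suc m \<in> group_center G"
      using pow_index_mem[OF normal_group_center assms] cC sub m by fastforce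
    from commutator_power[OF xy c this]
    \<comment> \<open>The witness for c^(n+1) is [x, y^2] followed by \<open>m\<close> copies of the
      conjugate y c y^(-1), which is again a commutator; this makes m+1 = n factors.\<close>
    have "c [^] Suc ?n = list_prod (?d # replicate m ?e)"
      unfolding m by (simp add: list_prod_replicate[OF eG] del: foldr_replicate nat_pow_Suc)
    moreover have "set (?d # replicate m ?e) \<subseteq> ?C"
      using d e by (simp add: set_replicate_conv_if del: UN_iff)
    ultimately show ?thesis using m by (intro exI[of _ "?d # replicate m ?e"]) simp
  qed
  have "finite (generate G ?C)"
    by (rule finite_generate[OF sub fin inv_mem_derived_set conj_mem_derived_set pow])
  then show ?thesis by (simp add: derived_def)
qed

text \<open>Since g x g^(-1) = [g, x] x, the class of \<open>x\<close> lies in a single coset of the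
  commutator subgroup.\<close>

lemma FC_group_if_finite_derived:
  assumes "finite (derived G (carrier G))"
  shows "FC_group G"
proof
  fix x assume x: "x \<in> carrier G"
  have "conjugacy_class G x \<subseteq> (\<lambda>c. c \<otimes> x) ` derived G (carrier G)"
  proof
    fix y assume "y \<in> conjugacy_class G x"
    then obtain g where g: "g \<in> carrier G" "y = g \<otimes> x \<otimes> inv g"
      by (auto simp: conjugacy_class_def)
    have "g \<otimes> x \<otimes> inv g \<otimes> inv x \<in> derived G (carrier G)"
      using g x unfolding derived_def by (intro generate.incl) blast
    then show "y \<in> (\<lambda>c. c \<otimes> x) ` derived G (carrier G)"
      using conj_eq_commutator_mult[of g x] g x by blast
  qed
  then show "finite (conjugacy_class G x)"
    using assms finite_surj by blast
qed

end

section \<open>Translations, cosets and subgroups of a topological group\<close>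

context topological_group
begin

lemma continuous_map_group_mult:
  assumes "continuous_map S T f" "continuous_map S T g"
  shows "continuous_map S T (\<lambda>x. f x \<otimes> g x)"
  using continuous_map_compose[OF continuous_map_pairedI[OF assms] continuous_mult]
  by (simp add: o_def)

lemma continuous_map_group_inv:
  assumes "continuous_map S T f"
  shows "continuous_map S T (\<lambda>x. inv (f x))"
  using continuous_map_compose[OF assms continuous_inv] by (simp add: o_def)

lemma continuous_map_group_const:
  assumes "g \<in> carrier G"
  shows "continuous_map S T (\<lambda>x. g)"
  using assms by (simp add: topspace_eq)

lemma openin_mult_left_vimage:
  assumes "openin T U" "g \<in> carrier G"
  shows "openin T {x \<in> carrier G. g \<otimes> x \<in> U}"
  using openin_continuous_map_preimage[OF continuous_map_group_mult
      [OF continuous_map_group_const[OF assms(2)] continuous_map_id[unfolded id_def]] assms(1)]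
  by (simp add: topspace_eq)

lemma openin_mult_right_vimage:
  assumes "openin T U" "g \<in> carrier G"
  shows "openin T {x \<in> carrier G. x \<otimes> g \<in> U}"
  using openin_continuous_map_preimage[OF continuous_map_group_mult
      [OF continuous_map_id[unfolded id_def] continuous_map_group_const[OF assms(2)]] assms(1)]
  by (simp add: topspace_eq)

lemma rcoset_eq_vimage:
  assumes "subgroup H G" "g \<in> carrier G"
  shows "H #> g = {x \<in> carrier G. x \<otimes> inv g \<in> H}"
proof -
  have "x \<in> H #> g" if "x \<in> carrier G" "x \<otimes> inv g \<in> H" for x
    using that assms by (auto simp: r_coset_def m_assoc intro!: bexI[of _ "x \<otimes> inv g"])
  moreover have "x \<in> carrier G \<and> x \<otimes> inv g \<in> H" if "x \<in> H #> g" for x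
    using that assms subgroup.mem_carrier[OF assms(1)] by (auto simp: r_coset_def m_assoc)
  ultimately show ?thesis by blast
qed

lemma openin_rcoset:
  assumes "subgroup H G" "openin T H" "g \<in> carrier G"
  shows "openin T (H #> g)"
  using openin_mult_right_vimage[OF assms(2), of "inv g"] rcoset_eq_vimage[OF assms(1,3)] assms(3)
  by simp

lemma closedin_rcoset:
  assumes "subgroup H G" "closedin T H" "g \<in> carrier G"
  shows "closedin T (H #> g)"
  using closedin_continuous_map_preimage[OF continuous_map_group_mult
      [OF continuous_map_id[unfolded id_def] continuous_map_group_const] assms(2), of "inv g"]
    rcoset_eq_vimage[OF assms(1,3)] assms(3)
  by (simp add: topspace_eq)

text \<open>Around each \<open>h\<close> in the subgroup, the translate of \<open>U\<close> by
  \<open>h\<close> is an open set that stays inside the subgroup.\<close>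

lemma openin_subgroup_if_neighborhood:
  assumes "subgroup H G" "openin T U" "\<one> \<in> U" "U \<subseteq> H"
  shows "openin T H"
proof (subst openin_subopen, intro ballI)
  fix h assume h: "h \<in> H"
  let ?V = "{x \<in> carrier G. inv h \<otimes> x \<in> U}"
  have hG: "h \<in> carrier G" using subgroup.mem_carrier[OF assms(1) h] .
  have "openin T ?V" using openin_mult_left_vimage[OF assms(2) inv_closed[OF hG]] .
  moreover have "h \<in> ?V" using hG assms(3) by simp
  moreover have "?V \<subseteq> H"
  proof
    fix x assume "x \<in> ?V"
    then have "x \<in> carrier G" "inv h \<otimes> x \<in> H" using assms(4) by auto
    then have "h \<otimes> (inv h \<otimes> x) \<in> H" by (intro subgroup.m_closed[OF assms(1) h])
    then show "x \<in> H" using hG \<open>x \<in> carrier G\<close> by simp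
  qed
  ultimately show "\<exists>V. openin T V \<and> h \<in> V \<and> V \<subseteq> H" by blast
qed

end

section \<open>Subgroups of finite index and uniformly small commutators in a compact group\<close>

context compact_group
begin

text \<open>The center is an intersection of equalizers of continuous maps into a Hausdorff space,
  one for each group element.\<close>

lemma closedin_group_center: "closedin T (group_center G)"
proof -
  have "closedin T {z \<in> topspace T. z \<otimes> g = g \<otimes> z}" if "g \<in> carrier G" for g
    using that by (intro closedin_continuous_maps_eq[OF Hausdorff] continuous_map_group_mult
        continuous_map_group_const continuous_map_id[unfolded id_def])
  then have "closedin T (\<Inter>g\<in>carrier G. {z \<in> topspace T. z \<otimes> g = g \<otimes> z})"
    using one_closed by (intro closedin_Inter) auto
  moreover have "(\<Inter>g\<in>carrier G. {z \<in> topspace T. z \<otimes> g = g \<otimes> z}) = group_center G"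
    using one_closed by (auto simp: group_center_def topspace_eq)
  ultimately show ?thesis by simp
qed

text \<open>The cosets of an open subgroup form an open cover by disjoint nonempty sets, so a finite
  subcover has to contain all of them.\<close>

lemma finite_index_if_open:
  assumes "subgroup H G" "openin T H"
  shows "finite (carrier (G Mod H))"
proof -
  interpret H: subgroup H G by fact
  have cover: "\<Union>(rcosets H) = topspace T"
    using rcosets_part_G[OF assms(1)] topspace_eq by simp
  moreover have "openin T U" if "U \<in> rcosets H" for U
    using that openin_rcoset[OF assms] by (auto simp: RCOSETS_def)
  ultimately obtain \<F> where F: "finite \<F>" "\<F> \<subseteq> rcosets H" "\<Union>\<F> = topspace T"
    using compact unfolding compact_space by metis
  have "rcosets H \<subseteq> \<F>"
  proof
    fix U assume U: "U \<in> rcosets H"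
    then obtain u where u: "u \<in> U" using H.rcosets_non_empty by blast
    then obtain V where V: "V \<in> \<F>" "u \<in> V" using F(3) cover U by blast
    then have "U = V"
      using rcos_disjoint[OF assms(1)] U u F(2) by (auto simp: pairwise_def disjnt_iff)
    with V show "U \<in> \<F>" by simp
  qed
  with F(1) show ?thesis by (simp add: FactGroup_def finite_subset)
qed

text \<open>The complement is the union of the finitely many other cosets, each of them
  closed.\<close>

lemma open_if_closed_finite_index:
  assumes "subgroup H G" "closedin T H" "finite (carrier (G Mod H))"
  shows "openin T H"
proof -
  interpret H: subgroup H G by fact
  have "H \<in> rcosets H" using H.subgroup_in_rcosets is_group by blast
  then have "U \<inter> H = {}" if "U \<in> rcosets H" "U \<noteq> H" for U
    using pairwiseD[OF rcos_disjoint[OF assms(1)]] that by (simp add: disjnt_def)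
  then have "carrier G - H = \<Union>(rcosets H - {H})"
    using rcosets_part_G[OF assms(1)] by blast
  moreover have "closedin T (\<Union>(rcosets H - {H}))"
    using assms(3) closedin_rcoset[OF assms(1,2)]
    by (intro closedin_Union) (auto simp: FactGroup_def RCOSETS_def)
  ultimately show ?thesis
    using H.subset by (simp add: openin_closedin_eq topspace_eq)
qed

text \<open>By the tube lemma the commutators \<open>[g, u]\<close> tend to \<open>\<one>\<close> as \<open>u \<rightarrow> \<one>\<close>, uniformly in \<open>g\<close>.\<close>

lemma small_commutators_avoid_finite:
  assumes "finite K"
  obtains U where "openin T U" "\<one> \<in> U"
    "\<And>g u. \<lbrakk>g \<in> carrier G; u \<in> U; g \<otimes> u \<otimes> inv g \<otimes> inv u \<in> K\<rbrakk> \<Longrightarrow> g \<otimes> u = u \<otimes> g"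
proof -
  let ?f = "\<lambda>p. fst p \<otimes> snd p \<otimes> inv (fst p) \<otimes> inv (snd p)"
  \<comment> \<open>Removing the nontrivial points of \<open>K\<close>, a finite and hence closed
    set, leaves an open neighborhood of the identity that meets \<open>K\<close> at most in the
    identity. Since [g, 1] = 1 for all \<open>g\<close>, the preimage \<open>?W\<close> contains the
    whole slice over the identity, as the tube lemma requires.\<close>
  let ?N = "carrier G - (K - {\<one>})"
  have closed: "closedin T (carrier G \<inter> (K - {\<one>}))"
    using assms by (intro closedin_Hausdorff_finite[OF Hausdorff]) (auto simp: topspace_eq)
  have N: "openin T ?N"
    using openin_diff[OF openin_topspace closed] by (simp add: topspace_eq Diff_Int)
  have cont: "continuous_map (prod_topology T T) T ?f"
    by (intro continuous_map_group_mult continuous_map_group_inv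
        continuous_map_fst continuous_map_snd)
  let ?W = "{p \<in> topspace (prod_topology T T). ?f p \<in> ?N}"
  have "openin (prod_topology T T) ?W"
    by (rule openin_continuous_map_preimage[OF cont N])
  moreover have "carrier G \<times> {\<one>} \<subseteq> ?W"
    by (auto simp: topspace_eq)
  ultimately obtain V U where U: "openin T U" "\<one> \<in> U" "carrier G \<subseteq> V" "V \<times> U \<subseteq> ?W"
    using tube_lemma_left[of T T ?W "carrier G" \<one>] compact topspace_eq
    by (auto simp: compact_space_def)
  show ?thesis
  proof (rule that[OF U(1,2)])
    fix g u assume g: "g \<in> carrier G" "u \<in> U" "g \<otimes> u \<otimes> inv g \<otimes> inv u \<in> K"
    have u: "u \<in> carrier G" using g U(1) openin_subset topspace_eq by blast
    have "(g, u) \<in> ?W" using g U by blast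
    then have "g \<otimes> u \<otimes> inv g \<otimes> inv u = \<one>" using g by simp
    then have "g \<otimes> u \<otimes> inv (u \<otimes> g) = \<one>" using g u by (simp add: m_assoc inv_mult_group)
    then show "g \<otimes> u = u \<otimes> g" using g u by (metis inv_equality inv_inv inv_closed m_closed)
  qed
qed

section \<open>Sizes of conjugacy classes and Baire's theorem\<close>

lemma conjugacy_class_eq_image: "conjugacy_class G x = (\<lambda>g. g \<otimes> x \<otimes> inv g) ` carrier G"
  by (auto simp: conjugacy_class_def)

lemma openin_inj_on_conj:
  assumes "finite F" "F \<subseteq> carrier G"
  shows "openin T {x \<in> carrier G. inj_on (\<lambda>g. g \<otimes> x \<otimes> inv g) F}"
proof -
  have "closedin T {x \<in> topspace T. g \<otimes> x \<otimes> inv g = h \<otimes> x \<otimes> inv h}"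
    if "g \<in> carrier G" "h \<in> carrier G" for g h
    using that by (intro closedin_continuous_maps_eq[OF Hausdorff] continuous_map_group_mult
        continuous_map_group_const continuous_map_id[unfolded id_def]) auto
  then have "closedin T (\<Union>(g, h)\<in>{(g, h) \<in> F \<times> F. g \<noteq> h}.
      {x \<in> topspace T. g \<otimes> x \<otimes> inv g = h \<otimes> x \<otimes> inv h})"
    using assms by (intro closedin_Union finite_imageI) (auto intro: finite_subset[of _ "F \<times> F"])
  moreover have "{x \<in> carrier G. inj_on (\<lambda>g. g \<otimes> x \<otimes> inv g) F} = topspace T -
      (\<Union>(g, h)\<in>{(g, h) \<in> F \<times> F. g \<noteq> h}.
        {x \<in> topspace T. g \<otimes> x \<otimes> inv g = h \<otimes> x \<otimes> inv h})"
    by (auto simp: topspace_eq inj_on_def)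
  ultimately show ?thesis by (simp add: openin_diff)
qed

text \<open>Class size is lower semicontinuous, so the sets \<open>F n\<close> of elements with
  class size at most \<open>n\<close> are closed. In an FC-group they cover the space, and by
  Baire's theorem one of them has nonempty interior.\<close>

lemma bounded_class_on_open:
  assumes "FC_group G"
  obtains n U where "openin T U" "U \<noteq> {}" "\<And>x. x \<in> U \<Longrightarrow> card (conjugacy_class G x) \<le> n"
proof -
  interpret FC_group G by fact
  define F where "F n = {x \<in> carrier G. card (conjugacy_class G x) \<le> n}" for n
  have closed: "closedin T (F n)" for n
  proof -
    have "openin T (carrier G - F n)"
    proof (subst openin_subopen, intro ballI)
      fix x assume "x \<in> carrier G - F n"
      then have x: "x \<in> carrier G" "n < card (conjugacy_class G x)" by (auto simp: F_def)
      \<comment> \<open>\<open>E\<close> contains exactly one conjugating element for each conjugate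
        of \<open>x\<close>. That these conjugates are distinct is an open condition, so nearby
        elements have at least as many conjugates as \<open>x\<close>.\<close>
      obtain E where E: "E \<subseteq> carrier G" "inj_on (\<lambda>g. g \<otimes> x \<otimes> inv g) E"
        "conjugacy_class G x = (\<lambda>g. g \<otimes> x \<otimes> inv g) ` E"
        using subset_image_inj[of "conjugacy_class G x" "\<lambda>g. g \<otimes> x \<otimes> inv g" "carrier G"]
          conjugacy_class_eq_image by auto
      have card: "card E = card (conjugacy_class G x)" using E card_image by metis
      then have "finite E" using x card.infinite by fastforce
      let ?V = "{y \<in> carrier G. inj_on (\<lambda>g. g \<otimes> y \<otimes> inv g) E}"
      have "?V \<subseteq> carrier G - F n"
      proof
        fix y assume y: "y \<in> ?V"
        then have "card E = card ((\<lambda>g. g \<otimes> y \<otimes> inv g) ` E)" by (simp add: card_image)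
        also have "\<dots> \<le> card (conjugacy_class G y)"
          using y E(1) finite_conjugacy_class
          by (intro card_mono) (auto simp: conjugacy_class_eq_image)
        finally show "y \<in> carrier G - F n" using y card x by (simp add: F_def)
      qed
      then show "\<exists>V. openin T V \<and> x \<in> V \<and> V \<subseteq> carrier G - F n"
        using openin_inj_on_conj[OF \<open>finite E\<close> E(1)] E x by (intro exI[of _ ?V]) simp
    qed
    then show ?thesis by (auto simp: closedin_def topspace_eq F_def)
  qed
  have cover: "\<Union>(range F) = topspace T"
    by (auto simp: F_def topspace_eq)
  have "\<exists>n. T interior_of F n \<noteq> {}"
  proof (rule ccontr)
    assume "\<nexists>n. T interior_of F n \<noteq> {}"
    then have "T interior_of \<Union>(range F) = {}"
      using compact Hausdorff closed
      by (intro Baire_category_alt)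
        (auto simp: compact_imp_locally_compact_space compact_Hausdorff_imp_regular_space)
    then have "carrier G = {}"
      unfolding cover interior_of_topspace by (simp add: topspace_eq)
    then show False using one_closed by blast
  qed
  then obtain n where n: "T interior_of F n \<noteq> {}" by blast
  show ?thesis
  proof (rule that[OF openin_interior_of n])
    show "card (conjugacy_class G x) \<le> n" if "x \<in> T interior_of F n" for x
      using subsetD[OF interior_of_subset that] by (simp add: F_def)
  qed
qed

lemma open_center_if_FC:
  assumes "FC_group G"
  shows "openin T (group_center G)"
proof -
  interpret FC_group G by fact
  let ?c = "\<lambda>x g. g \<otimes> x \<otimes> inv g"
  obtain n U where U: "openin T U" "U \<noteq> {}" "\<And>x. x \<in> U \<Longrightarrow> card (conjugacy_class G x) \<le> n"
    using bounded_class_on_open[OF assms] by metis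
  then obtain x where x: "x \<in> U"
    and max: "\<And>y. y \<in> U \<Longrightarrow> card (conjugacy_class G y) \<le> card (conjugacy_class G x)"
    using ex_has_greatest_nat[of "\<lambda>x. x \<in> U" _ "\<lambda>x. card (conjugacy_class G x)" "Suc n"]
    by (metis ex_in_conv less_Suc_eq_le)
  have UG: "U \<subseteq> carrier G" using U(1) openin_subset topspace_eq by blast
  then have xG: "x \<in> carrier G" using x by blast
  obtain E where E: "E \<subseteq> carrier G" "inj_on (?c x) E" "conjugacy_class G x = ?c x ` E"
    using subset_image_inj[of "conjugacy_class G x" "?c x" "carrier G"]
      conjugacy_class_eq_image by auto
  have "finite E" using E finite_conjugacy_class[OF xG] finite_image_iff by metis
  \<comment> \<open>If \<open>E\<close> gives distinct conjugates of \<open>y\<close>, their number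
    is the maximal class size on \<open>U\<close>, so they exhaust the class of
    \<open>y\<close>.\<close>
  have same_rep: "\<exists>f\<in>E. ?c y g = ?c y f"
    if y: "y \<in> U" "inj_on (?c y) E" and g: "g \<in> carrier G" for y g
  proof -
    have yG: "y \<in> carrier G" using y UG by blast
    have sub: "?c y ` E \<subseteq> conjugacy_class G y" using E(1) by (auto simp: conjugacy_class_eq_image)
    have "card (conjugacy_class G y) \<le> card (?c y ` E)"
      using max[OF y(1)] E y by (simp add: card_image)
    then have "?c y ` E = conjugacy_class G y"
      using card_seteq[OF finite_conjugacy_class[OF yG] sub] by blast
    then show ?thesis using g by (auto simp: conjugacy_class_eq_image)
  qed
  \<comment> \<open>\<open>K\<close> is chosen to contain the commutators [g, v] that arise below,
    without depending on \<open>v\<close>. The first part serves \<open>g\<close> in the centralizer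
    of \<open>x\<close>. The second serves \<open>f\<close> in \<open>E\<close>, since [f, v] = f (v
    f^(-1) v^(-1)).\<close>
  define K where "K = (\<lambda>f. inv x \<otimes> ?c x f) ` E \<union> (\<Union>f\<in>E. (\<lambda>d. f \<otimes> d) ` conjugacy_class G (inv f))"
  have "finite K"
    unfolding K_def using \<open>finite E\<close> E(1) finite_conjugacy_class by auto
  then obtain W where W: "openin T W" "\<one> \<in> W" and Wcomm:
    "\<And>g u. \<lbrakk>g \<in> carrier G; u \<in> W; g \<otimes> u \<otimes> inv g \<otimes> inv u \<in> K\<rbrakk> \<Longrightarrow> g \<otimes> u = u \<otimes> g"
    using small_commutators_avoid_finite by blast
  let ?V = "U \<inter> {y \<in> carrier G. inj_on (?c y) E}"
  \<comment> \<open>Membership in \<open>W\<close> turns a commutator lying in \<open>K\<close> into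
    a trivial one; the second condition makes \<open>same_rep\<close> applicable to
    \<open>x \<otimes> v\<close>.\<close>
  let ?N = "W \<inter> {v \<in> carrier G. x \<otimes> v \<in> ?V}"
  have "openin T ?N"
    using W U openin_inj_on_conj[OF \<open>finite E\<close> E(1)] openin_mult_left_vimage xG by blast
  moreover have "\<one> \<in> ?N" using W x xG E by simp
  moreover have "?N \<subseteq> group_center G"
  proof
    fix v assume v: "v \<in> ?N"
    have vG: "v \<in> carrier G" using v by blast
    have commE: "f \<otimes> v = v \<otimes> f" if f: "f \<in> E" for f
    proof (rule Wcomm)
      have "f \<otimes> v \<otimes> inv f \<otimes> inv v = f \<otimes> ?c (inv f) v"
        using f E(1) vG by (simp add: m_assoc subset_iff)
      moreover have "?c (inv f) v \<in> conjugacy_class G (inv f)"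
        using vG by (auto simp: conjugacy_class_eq_image)
      ultimately show "f \<otimes> v \<otimes> inv f \<otimes> inv v \<in> K" unfolding K_def using f by blast
    qed (use f E v in auto)
    \<comment> \<open>As \<open>g\<close> fixes \<open>x\<close> under conjugation, x (g v g^(-1))
      is a conjugate of x v, hence equals f (x v) f^(-1) for some \<open>f\<close> in
      \<open>E\<close>. This \<open>f\<close> commutes with \<open>v\<close> by
      \<open>commE\<close>, so the conjugate is f x f^(-1) v, and [g, v] = x^(-1) f x f^(-1) lies in
      the first part of \<open>K\<close>.\<close>
    have commx: "g \<otimes> v = v \<otimes> g" if g: "g \<in> carrier G" "g \<otimes> x = x \<otimes> g" for g
    proof (rule Wcomm)
      have "\<exists>f\<in>E. ?c (x \<otimes> v) g = ?c (x \<otimes> v) f"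
        using same_rep v g by blast
      then obtain f where f: "f \<in> E" "?c (x \<otimes> v) g = ?c (x \<otimes> v) f"
        by blast
      have fG: "f \<in> carrier G" using f E by blast
      have "x \<otimes> (g \<otimes> v \<otimes> inv g) = ?c (x \<otimes> v) g"
        using g xG vG by (simp flip: m_assoc)
      also have "\<dots> = f \<otimes> x \<otimes> (v \<otimes> inv f)"
        using f xG vG fG by (simp add: m_assoc)
      also have "v \<otimes> inv f = inv f \<otimes> v"
        using commE[OF f(1)] fG vG
        by (metis inv_closed inv_mult_cancel_left m_assoc m_closed r_inv r_one)
      finally have "g \<otimes> v \<otimes> inv g = inv x \<otimes> (f \<otimes> x \<otimes> (inv f \<otimes> v))"
        using xG vG fG g by (metis inv_closed inv_mult_cancel_left(1) m_closed)
      then have "g \<otimes> v \<otimes> inv g \<otimes> inv v = inv x \<otimes> ?c x f"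
        using xG vG fG by (simp add: m_assoc)
      then show "g \<otimes> v \<otimes> inv g \<otimes> inv v \<in> K" unfolding K_def using f by blast
    qed (use g v in auto)
    have "v \<otimes> g = g \<otimes> v" if g: "g \<in> carrier G" for g
    proof -
      have "\<exists>f\<in>E. ?c x g = ?c x f"
        using E(3) g by (auto simp: conjugacy_class_eq_image)
      then obtain f where f: "f \<in> E" "?c x g = ?c x f" by blast
      have fG: "f \<in> carrier G" using f E by blast
      \<comment> \<open>Since \<open>g\<close> and \<open>f\<close> conjugate \<open>x\<close> to
        the same element, \<open>h\<close> centralizes \<open>x\<close>; thus \<open>g\<close> is a
        product of two elements that commute with \<open>v\<close>.\<close>
      define h where "h = inv f \<otimes> g"
      have hG: "h \<in> carrier G" and gh: "g = f \<otimes> h" using fG g by (simp_all add: h_def)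
      have "g \<otimes> x = f \<otimes> x \<otimes> inv f \<otimes> g"
        using f(2) g xG fG by (metis inv_closed inv_solve_right m_closed)
      then have "h \<otimes> x = x \<otimes> h"
        using g xG fG by (simp add: h_def m_assoc)
      then have "h \<otimes> v = v \<otimes> h" using commx hG by blast
      then show "v \<otimes> g = g \<otimes> v"
        using commE[OF f(1)] gh hG fG vG by (metis m_assoc)
    qed
    with vG show "v \<in> group_center G" by (simp add: group_center_def)
  qed
  ultimately show ?thesis
    using openin_subgroup_if_neighborhood normal_group_center normal_imp_subgroup by blast
qed

end

theorem theorem1p1:
  fixes G :: "('a, 'b) monoid_scheme" and T :: "'a topology"
  assumes "compact_group G T"
  shows "(FC_group G \<longleftrightarrow> openin T (group_center G)) \<and>
    (openin T (group_center G) \<longleftrightarrow> finite (carrier (G Mod group_center G))) \<and>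
    (openin T (group_center G) \<longleftrightarrow> finite (derived G (carrier G)))"
proof -
  interpret compact_group G T by fact
  have Z: "subgroup (group_center G) G" using normal_group_center normal_imp_subgroup by blast
  \<comment> \<open>The implications run in a cycle: FC-group, open center, center of finite index,
    finite commutator subgroup, FC-group.\<close>
  show ?thesis
    using open_center_if_FC finite_index_if_open[OF Z] Schur_finite_derived
      open_if_closed_finite_index[OF Z closedin_group_center] FC_group_if_finite_derived
    by blast
qed

end
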